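(* The first uncountable ordinal $\omega_1$, with its order topology, is a non-compact space that has bounded cliques: for every closed orthogonality relation $R$ on $\omega_1$ there exists a natural number $n$ such that $|A| \leq n$ for every $R$-clique $A \subseteq \omega_1$.
   Context: An orthogonality relation on a set $X$ is a symmetric, irreflexive binary relation $R \subseteq X \times X$. For a topological space $X$, $R$ is closed if it is a closed subset of $X \times X$ with the product topology. An $R$-clique is a subset $A \subseteq X$ any two distinct points of which are $R$-related. *)

theory Defs
  imports "HOL-Analysis.Analysis" "HOL-Library.Countable_Set_Type"
begin

text \<open>
  The library has no ordinals as such. As usual, the least uncountable ordinal is the initial
  ordinal of the cardinal successor of \<open>\<aleph>\<^sub>0\<close>; \<^term>\<open>cardSuc natLeq\<close> is
  the corresponding well-order (fixed up to isomorphism). The lemmas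
  \<open>uncountable_omega1\<close> and \<open>countable_lessThan_omega1\<close> below confirm the order type:
  up to isomorphism there is exactly one uncountable well-order with countable proper initial
  segments.
\<close>

lemma Card_order_cardSuc_natLeq: "Card_order (cardSuc natLeq)"
  by (rule cardSuc_Card_order[OF natLeq_Card_order])

lemma Well_order_cardSuc_natLeq: "Well_order (cardSuc natLeq)"
  by (rule cardSuc_Well_order[OF natLeq_Card_order])

typedef omega1 = "Field (cardSuc natLeq)"
  using Field_cardSuc_not_empty[OF natLeq_Card_order] by blast

instantiation omega1 :: linorder
begin

definition less_eq_omega1_def:
  "x \<le> y \<longleftrightarrow> (Rep_omega1 x, Rep_omega1 y) \<in> cardSuc natLeq"

definition less_omega1_def:
  "x < y \<longleftrightarrow> x \<le> y \<and> x \<noteq> y" for x y :: omega1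

instance
proof
  have lin: "refl_on (Field (cardSuc natLeq)) (cardSuc natLeq)" "trans (cardSuc natLeq)"
    "antisym (cardSuc natLeq)" "total_on (Field (cardSuc natLeq)) (cardSuc natLeq)"
    using Well_order_cardSuc_natLeq
    by (simp_all add: well_order_on_def linear_order_on_def partial_order_on_def preorder_on_def)
  fix x y z :: omega1
  show refl: "x \<le> x"
    using refl_onD[OF lin(1) Rep_omega1] by (simp add: less_eq_omega1_def)
  show "x \<le> y \<Longrightarrow> y \<le> z \<Longrightarrow> x \<le> z"
    unfolding less_eq_omega1_def using lin(2) by (rule transD)
  show antisym: "x \<le> y \<Longrightarrow> y \<le> x \<Longrightarrow> x = y"
    unfolding less_eq_omega1_def by (rule iffD1[OF Rep_omega1_inject], rule antisymD[OF lin(3)])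
  show "x \<le> y \<or> y \<le> x"
  proof (cases "x = y")
    case True
    then show ?thesis using refl by simp
  next
    case False
    then have "Rep_omega1 x \<noteq> Rep_omega1 y" by (simp add: Rep_omega1_inject)
    then show ?thesis
      unfolding less_eq_omega1_def
      by (rule lin(4)[unfolded total_on_def, rule_format, OF Rep_omega1 Rep_omega1])
  qed
  show "x < y \<longleftrightarrow> x \<le> y \<and> \<not> y \<le> x"
    using antisym refl by (auto simp: less_omega1_def)
qed

end

instance omega1 :: wellorder
proof
  fix P :: "omega1 \<Rightarrow> bool" and a
  assume step: "\<And>x. (\<And>y. y < x \<Longrightarrow> P y) \<Longrightarrow> P x"
  have "wf (inv_image (cardSuc natLeq - Id) Rep_omega1)"
    using Well_order_cardSuc_natLeq by (simp add: well_order_on_def)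
  moreover have "inv_image (cardSuc natLeq - Id) Rep_omega1 = {(x, y). x < y}"
    by (auto simp: inv_image_def less_omega1_def less_eq_omega1_def Rep_omega1_inject)
  ultimately have "wf {(x::omega1, y). x < y}" by simp
  then show "P a"
    by (induction a rule: wf_induct_rule) (use step in blast)
qed

lemma uncountable_omega1:
  includes cardinal_syntax
  shows "uncountable (UNIV :: omega1 set)"
proof
  assume "countable (UNIV :: omega1 set)"
  then have "countable (range Rep_omega1)" by (rule countable_image)
  then have "countable (Field (cardSuc natLeq))"
    by (simp add: type_definition.Rep_range[OF type_definition_omega1])
  then have "|Field (cardSuc natLeq)| \<le>o natLeq"
    by (simp only: countable_card_le_natLeq)
  then have "cardSuc natLeq \<le>o natLeq"
    by (rule ordIso_ordLeq_trans[OF ordIso_symmetric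
          [OF card_of_Field_ordIso[OF Card_order_cardSuc_natLeq]]])
  then show False
    using cardSuc_greater[OF natLeq_Card_order] not_ordLess_ordLeq[of natLeq "cardSuc natLeq"]
    by simp
qed

lemma countable_lessThan_omega1:
  includes cardinal_syntax
  shows "countable {..<a :: omega1}"
proof -
  have "|underS (cardSuc natLeq) (Rep_omega1 a)| <o cardSuc natLeq"
    by (rule card_of_underS[OF Card_order_cardSuc_natLeq Rep_omega1])
  then have "|underS (cardSuc natLeq) (Rep_omega1 a)| \<le>o natLeq"
    by (simp only: cardSuc_ordLeq_ordLess[OF natLeq_Card_order card_of_Card_order])
  then have "countable (underS (cardSuc natLeq) (Rep_omega1 a))"
    by (simp only: countable_card_le_natLeq)
  moreover have "Rep_omega1 ` {..<a} \<subseteq> underS (cardSuc natLeq) (Rep_omega1 a)"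
    by (auto simp: underS_def less_omega1_def less_eq_omega1_def Rep_omega1_inject)
  ultimately have "countable (Rep_omega1 ` {..<a})" by (rule countable_subset[rotated])
  then show ?thesis
    by (rule countable_image_inj_on) (simp add: inj_on_def Rep_omega1_inject)
qed

instantiation omega1 :: linorder_topology
begin

definition open_omega1 :: "omega1 set \<Rightarrow> bool" where
  "open_omega1 = generate_topology (range (\<lambda>a. {..<a}) \<union> range (\<lambda>a. {a<..}))"

instance by standard (rule open_omega1_def)

end

definition orthogonality_on :: "'a set \<Rightarrow> 'a rel \<Rightarrow> bool" where
  "orthogonality_on X R \<longleftrightarrow> R \<subseteq> X \<times> X \<and> sym R \<and> irrefl R"

definition rel_clique :: "'a set \<Rightarrow> 'a rel \<Rightarrow> 'a set \<Rightarrow> bool" where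
  "rel_clique X R A \<longleftrightarrow> A \<subseteq> X \<and> (\<forall>x\<in>A. \<forall>y\<in>A. x \<noteq> y \<longrightarrow> (x, y) \<in> R)"

text \<open>Finiteness is stated explicitly because \<^const>\<open>card\<close> is 0 on infinite sets.\<close>

definition has_bounded_cliques :: "'a topology \<Rightarrow> bool" where
  "has_bounded_cliques T \<longleftrightarrow>
    (\<forall>R. orthogonality_on (topspace T) R \<and> closedin (prod_topology T T) R \<longrightarrow>
      (\<exists>n::nat. \<forall>A. rel_clique (topspace T) R A \<longrightarrow> finite A \<and> card A \<le> n))"

end

theory Submission
  imports Defs
begin

text \<open>
  A closed irreflexive relation avoids a square neighbourhood of every diagonal point. Hence, by
  well-founded induction, every initial segment \<open>{..a}\<close> is covered by finitely many sets on which
  the relation is empty, and each of them contains at most one point of a clique. Moreover the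
  relation is empty on some final segment \<open>{c<..}\<close>: otherwise related pairs could be chosen
  cofinally in a sequence of ordinals with supremum \<open>b\<close>, in every neighbourhood of \<open>(b, b)\<close>.
\<close>

lemma closed_irrefl_avoids_square:
  fixes R :: "'a::topological_space rel"
  assumes "closed R" "irrefl R"
  obtains U where "open U" "a \<in> U" "U \<times> U \<inter> R = {}"
proof -
  have "open (- R)" "(a, a) \<in> - R"
    using assms by (auto simp: irrefl_def)
  then obtain V W where "open V" "open W" "a \<in> V" "a \<in> W" "V \<times> W \<subseteq> - R"
    by (auto elim!: open_prod_elim)
  then show thesis
    by (intro that[of "V \<inter> W"]) auto
qed

text \<open>The point \<open>c\<close> only witnesses that \<open>a\<close> is not least, so that
  every neighbourhood of \<open>a\<close> contains some \<open>{b<..a}\<close>. Keeping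
  \<open>a\<close> as right endpoint lets this interval complete \<open>{..b}\<close> to
  \<open>{..a}\<close>.\<close>

lemma closed_irrefl_avoids_left_interval:
  fixes R :: "'a::linorder_topology rel"
  assumes "closed R" "irrefl R" "c < a"
  obtains b where "b < a" "{b<..a} \<times> {b<..a} \<inter> R = {}"
proof -
  obtain U where "open U" "a \<in> U" "U \<times> U \<inter> R = {}"
    using closed_irrefl_avoids_square assms(1,2) by metis
  moreover from this obtain b where "b < a" "{b<..a} \<subseteq> U"
    using open_left[OF _ _ \<open>c < a\<close>] by metis
  ultimately show thesis
    by (intro that[of b]) auto
qed

lemma rel_clique_subset: "rel_clique X R A \<Longrightarrow> B \<subseteq> A \<Longrightarrow> rel_clique X R B"
  by (auto simp: rel_clique_def)

lemma clique_in_free_set: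
  assumes "rel_clique X R A" "A \<subseteq> B" "B \<times> B \<inter> R = {}"
  shows "finite A" "card A \<le> 1"
proof -
  have "\<forall>x\<in>A. \<forall>y\<in>A. x = y"
    using assms unfolding rel_clique_def by blast
  then show "finite A" "card A \<le> 1"
    by (metis finite.simps is_singletonI' is_singleton_def,
        metis One_nat_def card_le_Suc0_iff_eq card.infinite zero_le_one)
qed

text \<open>A clique meets the \<open>R\<close>-free set \<open>C\<close> in at most one point, and
  its part in \<open>B\<close> is again a clique.\<close>

lemma clique_bound_Suc:
  assumes "\<And>A. rel_clique X R A \<Longrightarrow> A \<subseteq> B \<Longrightarrow> finite A \<and> card A \<le> n"
    and "C \<times> C \<inter> R = {}"
    and "rel_clique X R A" "A \<subseteq> B \<union> C"
  shows "finite A \<and> card A \<le> Suc n"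
proof -
  have B: "finite (A \<inter> B) \<and> card (A \<inter> B) \<le> n"
    using assms(1,3) rel_clique_subset by (metis Int_lower1 Int_lower2)
  have C: "finite (A \<inter> C)" "card (A \<inter> C) \<le> 1"
    using clique_in_free_set[OF rel_clique_subset[OF assms(3), of "A \<inter> C"] _ assms(2)] by auto
  have "A = (A \<inter> B) \<union> (A \<inter> C)"
    using assms(4) by auto
  then show ?thesis
    using B C card_Un_le[of "A \<inter> B" "A \<inter> C"]
    by (metis Suc_eq_plus1 add_mono finite_UnI order_trans)
qed

lemma bounded_cliques_atMost:
  fixes R :: "'a::{wellorder,linorder_topology} rel"
  assumes "closed R" "irrefl R"
  shows "\<exists>n. \<forall>A. rel_clique X R A \<longrightarrow> A \<subseteq> {..a} \<longrightarrow> finite A \<and> card A \<le> n"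
proof (induction a rule: less_induct)
  case (less a)
  show ?case
  proof (cases "\<exists>c. c < a")
    case True
    then obtain b where b: "b < a" "{b<..a} \<times> {b<..a} \<inter> R = {}"
      using closed_irrefl_avoids_left_interval assms by metis
    obtain n where "\<And>A. rel_clique X R A \<Longrightarrow> A \<subseteq> {..b} \<Longrightarrow> finite A \<and> card A \<le> n"
      using less[OF b(1)] by blast
    moreover have "{..a} = {..b} \<union> {b<..a}"
      using b(1) by auto
    ultimately show ?thesis
      using clique_bound_Suc[OF _ b(2)] by metis
  next
    case False
    \<comment> \<open>Here \<open>a\<close> is the least element, so there is no left interval to
      split off.\<close>
    then have "{..a} = {a}"
      by (auto simp: not_less order.antisym)
    moreover have "{a} \<times> {a} \<inter> R = {}"
      using assms(2) by (auto simp: irrefl_def)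
    ultimately show ?thesis
      using clique_in_free_set by metis
  qed
qed

text \<open>Uncountable cofinality: countably many countable initial segments cannot cover
  \<open>omega1\<close>, and any point outside their union is a strict bound.\<close>

lemma countable_omega1_strict_bound:
  fixes S :: "omega1 set"
  assumes "countable S"
  obtains b where "\<And>s. s \<in> S \<Longrightarrow> s < b"
proof -
  have "countable {..s}" for s :: omega1
    using countable_lessThan_omega1[of s] by (simp flip: ivl_disj_un_singleton(2))
  then have "countable (\<Union>s\<in>S. {..s})"
    using assms by simp
  then have "(\<Union>s\<in>S. {..s}) \<noteq> UNIV"
    using uncountable_omega1 by metis
  then obtain b where "\<And>s. s \<in> S \<Longrightarrow> \<not> b \<le> s"
    by auto
  then show thesis
    by (intro that[of b]) (simp add: not_le)
qed

lemma closed_irrefl_avoids_final_square: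
  fixes R :: "omega1 rel"
  assumes "closed R" "irrefl R"
  shows "\<exists>c. {c<..} \<times> {c<..} \<inter> R = {}"
proof (rule ccontr)
  assume "\<nexists>c. {c<..} \<times> {c<..} \<inter> R = {}"
  then have "\<forall>c. \<exists>x y. c < x \<and> c < y \<and> (x, y) \<in> R"
    by fastforce
  then obtain f g where fg: "\<And>c. c < f c" "\<And>c. c < g c" "\<And>c. (f c, g c) \<in> R"
    by metis
  \<comment> \<open>The starting point is arbitrary. Taking the maximum puts both members of the
    related pair chosen beyond \<open>s n\<close> into \<open>{s n<..s (Suc n)}\<close>.\<close>
  define s where "s n = ((\<lambda>c. max (f c) (g c)) ^^ n) undefined" for n
  have s_Suc: "s (Suc n) = max (f (s n)) (g (s n))" for n
    by (simp add: s_def)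
  define b where "b = (LEAST b. \<forall>n. s n \<le> b)"
  have "\<exists>b. \<forall>n. s n \<le> b"
    using countable_omega1_strict_bound[of "range s"]
    by (metis countableI_type countable_image rangeI less_imp_le)
  then have ub: "s n \<le> b" for n
    unfolding b_def by (rule LeastI2_ex) simp
  \<comment> \<open>This shows that \<open>b\<close> is not least, as the left interval lemma
    requires.\<close>
  have "s 0 < b"
    using fg(1)[of "s 0"] ub[of "Suc 0"] by (auto simp: s_Suc)
  then obtain c where c: "c < b" "{c<..b} \<times> {c<..b} \<inter> R = {}"
    using closed_irrefl_avoids_left_interval assms by metis
  \<comment> \<open>By minimality of \<open>b\<close>, the smaller \<open>c\<close> is not an upper
    bound of the sequence.\<close>
  obtain n where "c < s n"
    using not_less_Least[OF c(1)[unfolded b_def]] by (auto simp: not_le)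
  then have "f (s n) \<in> {c<..b}" "g (s n) \<in> {c<..b}"
    using fg(1,2)[of "s n"] ub[of "Suc n"] by (auto simp: s_Suc)
  then show False
    using c(2) fg(3)[of "s n"] by blast
qed

text \<open>Compactness would give a greatest element, yet every singleton has a strict upper
  bound.\<close>

lemma not_compact_omega1: "\<not> compact (UNIV :: omega1 set)"
proof
  assume "compact (UNIV :: omega1 set)"
  then obtain m :: omega1 where "\<forall>x. x \<le> m"
    using compact_attains_sup[of "UNIV :: omega1 set"] by auto
  then show False
    using countable_omega1_strict_bound[of "{m}"] by (auto simp: not_less[symmetric])
qed

lemma has_bounded_cliques_omega1: "has_bounded_cliques (euclidean :: omega1 topology)"
  unfolding has_bounded_cliques_def
proof (intro allI impI)
  fix R :: "omega1 rel"
  let ?X = "topspace (euclidean :: omega1 topology)"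
  assume "orthogonality_on ?X R \<and> closedin (prod_topology euclidean euclidean) R"
  then have R: "closed R" "irrefl R"
    by (auto simp: orthogonality_on_def)
  obtain c where c: "{c<..} \<times> {c<..} \<inter> R = {}"
    using closed_irrefl_avoids_final_square[OF R] ..
  obtain n where n: "\<And>A. rel_clique ?X R A \<Longrightarrow> A \<subseteq> {..c} \<Longrightarrow> finite A \<and> card A \<le> n"
    using bounded_cliques_atMost[OF R] by metis
  \<comment> \<open>The \<open>R\<close>-free final segment adds at most one point to the bound for
    \<open>{..c}\<close>.\<close>
  have "A \<subseteq> {..c} \<union> {c<..}" for A
    by auto
  then show "\<exists>n. \<forall>A. rel_clique ?X R A \<longrightarrow> finite A \<and> card A \<le> n"
    using clique_bound_Suc[OF n c] by metis
qed

theorem mainTheorem4: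
  shows "\<not> compact_space (euclidean :: omega1 topology) \<and>
         has_bounded_cliques (euclidean :: omega1 topology)"
  using not_compact_omega1 has_bounded_cliques_omega1 by (simp add: compact_space_def)

end
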